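(* Let $K$ be a subcomplex of a finite simplicial complex $L$, let $k\ge 0$, and let $\beta$ be a $k$-cocycle on $K$ whose class $[\beta]_K\in \mathrm{H}^k(K)$ dies between $K$ and $L$. Let $\delta_L^k\hat\beta$ be the death cochain. Then $$\|\delta_L^k \hat{\beta}\|_2^2 = \left\langle \mathrm{Sch}\left(\Delta_L^{k,\mathrm{up}},\epsilon(\mathrm{C}^k(K))\right)\epsilon(\beta),\, \epsilon(\beta) \right\rangle.$$ Moreover, when $\beta$ is harmonic on $K$ (that is, $\delta_K^k\beta=0$ and $(\delta_K^{k-1})^*\beta=0$), $$\|\delta_L^k \hat{\beta}\|_2^2 = \left\langle \Delta^{k,\mathrm{up}}_{L,K} (\epsilon(\beta)), \epsilon (\beta)\right\rangle.$$
   Context: All simplicial complexes are finite and all (co)homology has real coefficients. $\mathrm{C}^k(X)$ is the space of real-valued functions on the set of $k$-simplices of $X$ (with orientations fixed), with inner product $\langle\alpha,\beta\rangle=\sum_\sigma \alpha(\sigma)\beta(\sigma)$ and norm $\|\cdot\|_2$; $\delta_X^k:\mathrm{C}^k(X)\to \mathrm{C}^{k+1}(X)$ is the coboundary operator ($\delta_X^{-1}=0$), and $(\cdot)^*$ denotes adjoints between finite-dimensional inner product spaces. For $\varphi\in \mathrm{C}^k(L)$, $\varphi|_K$ is its restriction to the $k$-simplices of $K$. $\epsilon:\mathrm{C}^k(K)\hookrightarrow \mathrm{C}^k(L)$ is extension by zero on $k$-simplices of $L$ not in $K$. $\Delta_L^{k,\mathrm{up}}=(\delta_L^k)^*\delta_L^k:\mathrm{C}^k(L)\to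 \mathrm{C}^k(L)$. Death: $[\beta]_K\in \mathrm{H}^k(K)$ dies between $K$ and $L$ if $\beta$ cannot be extended to a $k$-cocycle on $L$. The death cochain is then $\delta_L^k\hat\beta$, where $\hat\beta$ is any element of $\operatorname{arg\,min}_{\beta'\in \mathrm{C}^k(L)}\{\|\delta_L^k\beta'\|_2 : \beta'|_K=\beta\}$. Schur restriction: let $\Delta:V\to V$ be a self-adjoint positive semidefinite operator on a finite-dimensional inner product space and $V=W\oplus W^\perp$. Write $\Delta=\begin{pmatrix}\Delta_{WW}&\Delta_{W\perp}\\ \Delta_{\perp W}&\Delta_{\perp\perp}\end{pmatrix}$ in block form for this decomposition. Then $\mathrm{Sch}(\Delta,W):W\to W$ is the operator $\Delta_{WW}-\Delta_{W\perp}\Delta_{\perp\perp}^{+}\Delta_{\perp W}$, where $(\cdot)^+$ is the Moore–Penrose pseudoinverse. Persistent up Laplacian: let $$\mathrm{C}^{k+1}_{L,K}=\left\{\xi\in \mathrm{C}^{k+1}(L) \;\middle|\; (\delta_L^k)^*(\xi)\in \epsilon\big(\ker((\delta_K^{k-1})^* )\big)\right\}\subseteq \mathrm{C}^{k+1}(L),$$ with the inherited inner product, and let $\partial_{k+1}^{L,K}:\mathrm{C}^{k+1}_{L,K}\to \epsilon(\mathrm{C}^k(K))$ be the restriction of $(\delta_L^k)^*$. Then $\Delta^{k,\mathrm{up}}_{L,K}=\partial_{k+1}^{L,K}\circ(\partial_{k+1}^{L,K})^*:\epsilon(\mathrm{C}^k(K))\to \epsilon(\mathrm{C}^k(K))$.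 *)

theory Defs
  imports "HOL-Analysis.Analysis" "HOL-Combinatorics.Permutations"
begin

section \<open>Linear maps between subspaces\<close>

text \<open>
  Finite-dimensional inner product spaces occur as subspaces of a Euclidean space, with the
  inherited inner product.  An operator \<open>f : U \<rightarrow> V\<close> is a function on the ambient space of which
  only the values on \<open>U\<close> matter.
\<close>

definition adjoint_on ::
  "'a::euclidean_space set \<Rightarrow> 'b::euclidean_space set \<Rightarrow> ('a \<Rightarrow> 'b) \<Rightarrow> 'b \<Rightarrow> 'a" where
  "adjoint_on U V f =
     (SOME g. (\<forall>v\<in>V. g v \<in> U) \<and> (\<forall>u\<in>U. \<forall>v\<in>V. f u \<bullet> v = u \<bullet> g v))"

text \<open>The Moore--Penrose pseudoinverse of \<open>f : U \<rightarrow> V\<close>, through the four Penrose conditions.\<close>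

definition is_pinv_on ::
  "'a::euclidean_space set \<Rightarrow> 'b::euclidean_space set \<Rightarrow> ('a \<Rightarrow> 'b) \<Rightarrow> ('b \<Rightarrow> 'a) \<Rightarrow> bool" where
  "is_pinv_on U V f g \<longleftrightarrow>
     linear g \<and> (\<forall>v\<in>V. g v \<in> U) \<and>
     (\<forall>u\<in>U. f (g (f u)) = f u) \<and>
     (\<forall>v\<in>V. g (f (g v)) = g v) \<and>
     (\<forall>v\<in>V. \<forall>w\<in>V. f (g v) \<bullet> w = v \<bullet> f (g w)) \<and>
     (\<forall>u\<in>U. \<forall>w\<in>U. g (f u) \<bullet> w = u \<bullet> g (f w))"

definition pinv_on ::
  "'a::euclidean_space set \<Rightarrow> 'b::euclidean_space set \<Rightarrow> ('a \<Rightarrow> 'b) \<Rightarrow> 'b \<Rightarrow> 'a" where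
  "pinv_on U V f = (SOME g. is_pinv_on U V f g)"

text \<open>
  The block \<open>A \<rightarrow> B\<close> of an operator \<open>D\<close>: restrict to \<open>A\<close>, then project orthogonally onto \<open>B\<close>
  (for a subspace \<open>B\<close>, the closest point is the orthogonal projection).
\<close>

definition block ::
  "('a::euclidean_space \<Rightarrow> 'a) \<Rightarrow> 'a set \<Rightarrow> 'a set \<Rightarrow> 'a \<Rightarrow> 'a" where
  "block D A B = (\<lambda>x. closest_point B (D x))"

text \<open>
  Schur restriction to \<open>W\<close> of a self-adjoint positive semidefinite operator \<open>D : V \<rightarrow> V\<close>.
  The orthogonal complement of \<open>W\<close> is taken inside \<open>V\<close>, not in the ambient space.
\<close>

definition schur_restriction ::
  "'a::euclidean_space set \<Rightarrow> ('a \<Rightarrow> 'a) \<Rightarrow> 'a set \<Rightarrow> 'a \<Rightarrow> 'a" where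
  "schur_restriction V D W =
     (let P = V \<inter> orthogonal_comp W in
      (\<lambda>w. block D W W w -
            block D P W (pinv_on P P (block D P P) (block D W P w))))"


section \<open>Simplicial complexes and cochains\<close>

text \<open>
  Abstract simplicial complexes on a finite vertex type; not every element of the type needs to
  be a vertex.  The empty set is not a simplex.  Dimensions are integers: there are no
  \<open>(-1)\<close>-simplices, so the space of \<open>(-1)\<close>-cochains is zero, and so is \<open>\<delta>\<close> on it.
\<close>

definition abstract_simplicial_complex :: "'a::finite set set \<Rightarrow> bool" where
  "abstract_simplicial_complex X \<longleftrightarrow>
     {} \<notin> X \<and> (\<forall>\<sigma>\<in>X. \<forall>\<tau>. \<tau> \<subseteq> \<sigma> \<and> \<tau> \<noteq> {} \<longrightarrow> \<tau> \<in> X)"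

definition simplices :: "'a::finite set set \<Rightarrow> int \<Rightarrow> 'a set set" where
  "simplices X k = {\<sigma> \<in> X. int (card \<sigma>) = k + 1}"

text \<open>
  An orientation chooses an ordering of the vertices of every simplex.  A subcomplex carries the
  orientation of the larger complex.
\<close>

definition orientation :: "'a::finite set set \<Rightarrow> ('a set \<Rightarrow> 'a list) \<Rightarrow> bool" where
  "orientation X ori \<longleftrightarrow> (\<forall>\<sigma>\<in>X. distinct (ori \<sigma>) \<and> set (ori \<sigma>) = \<sigma>)"

text \<open>
  Cochains of all complexes and degrees live in the Euclidean space of functions on vertex sets;
  a \<open>k\<close>-cochain of \<open>X\<close> is zero off the \<open>k\<close>-simplices of \<open>X\<close>.  The ambient inner product and
  norm restrict to the standard ones.
\<close>

definition cochains :: "'a::finite set set \<Rightarrow> int \<Rightarrow> (real ^ ('a set)) set" where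
  "cochains X k = {\<phi>. \<forall>\<sigma>. \<sigma> \<notin> simplices X k \<longrightarrow> \<phi> $ \<sigma> = 0}"

definition reordering_sign :: "'a list \<Rightarrow> 'a list \<Rightarrow> int" where
  "reordering_sign vs ws = sign (THE p. p permutes set vs \<and> map p vs = ws)"

text \<open>The value of a cochain on the oriented simplex \<open>[v\<^sub>0, \<dots>, v\<^sub>k]\<close>.\<close>

definition cochain_value ::
  "('a::finite set \<Rightarrow> 'a list) \<Rightarrow> real ^ ('a set) \<Rightarrow> 'a list \<Rightarrow> real" where
  "cochain_value ori \<phi> vs = of_int (reordering_sign (ori (set vs)) vs) * \<phi> $ set vs"

text \<open>
  \<open>(\<delta>\<phi>)[v\<^sub>0, \<dots>, v\<^sub>n]\<close> is the alternating sum of the values of \<open>\<phi>\<close> on the oriented faces obtained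
  by omitting one \<open>v\<^sub>i\<close>.
\<close>

definition coboundary ::
  "('a::finite set \<Rightarrow> 'a list) \<Rightarrow> 'a set set \<Rightarrow> int \<Rightarrow> real ^ ('a set) \<Rightarrow> real ^ ('a set)" where
  "coboundary ori X k \<phi> =
     (\<chi> \<tau>. if \<tau> \<in> simplices X (k + 1)
           then \<Sum>i<length (ori \<tau>).
                  (-1) ^ i * cochain_value ori \<phi> (take i (ori \<tau>) @ drop (Suc i) (ori \<tau>))
           else 0)"

definition coboundary_adj ::
  "('a::finite set \<Rightarrow> 'a list) \<Rightarrow> 'a set set \<Rightarrow> int \<Rightarrow> real ^ ('a set) \<Rightarrow> real ^ ('a set)" where
  "coboundary_adj ori X k = adjoint_on (cochains X k) (cochains X (k + 1)) (coboundary ori X k)"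

definition up_laplacian ::
  "('a::finite set \<Rightarrow> 'a list) \<Rightarrow> 'a set set \<Rightarrow> int \<Rightarrow> real ^ ('a set) \<Rightarrow> real ^ ('a set)" where
  "up_laplacian ori X k = coboundary_adj ori X k \<circ> coboundary ori X k"

definition cocycles ::
  "('a::finite set \<Rightarrow> 'a list) \<Rightarrow> 'a set set \<Rightarrow> int \<Rightarrow> (real ^ ('a set)) set" where
  "cocycles ori X k = {\<phi> \<in> cochains X k. coboundary ori X k \<phi> = 0}"

definition harmonic_cochains ::
  "('a::finite set \<Rightarrow> 'a list) \<Rightarrow> 'a set set \<Rightarrow> int \<Rightarrow> (real ^ ('a set)) set" where
  "harmonic_cochains ori X k =
     {\<phi> \<in> cochains X k. coboundary ori X k \<phi> = 0 \<and> coboundary_adj ori X (k - 1) \<phi> = 0}"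


section \<open>Pairs of complexes\<close>

definition restrict_cochain ::
  "'a::finite set set \<Rightarrow> int \<Rightarrow> real ^ ('a set) \<Rightarrow> real ^ ('a set)" where
  "restrict_cochain K k \<phi> = (\<chi> \<sigma>. if \<sigma> \<in> simplices K k then \<phi> $ \<sigma> else 0)"

text \<open>
  As cochains are already zero off their complex, extension by zero from \<open>K\<close> to \<open>L\<close> has the
  same underlying vector.
\<close>

definition extend_zero ::
  "'a::finite set set \<Rightarrow> 'a set set \<Rightarrow> int \<Rightarrow> real ^ ('a set) \<Rightarrow> real ^ ('a set)" where
  "extend_zero K L k \<phi> =
     (\<chi> \<sigma>. if \<sigma> \<in> simplices L k \<and> \<sigma> \<in> simplices K k then \<phi> $ \<sigma> else 0)"

definition dies ::
  "('a::finite set \<Rightarrow> 'a list) \<Rightarrow> 'a set set \<Rightarrow> 'a set set \<Rightarrow> int \<Rightarrow> real ^ ('a set) \<Rightarrow> bool" where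
  "dies ori K L k \<beta> \<longleftrightarrow> \<not> (\<exists>\<phi> \<in> cocycles ori L k. restrict_cochain K k \<phi> = \<beta>)"

definition minimal_extension ::
  "('a::finite set \<Rightarrow> 'a list) \<Rightarrow> 'a set set \<Rightarrow> 'a set set \<Rightarrow> int \<Rightarrow>
   real ^ ('a set) \<Rightarrow> real ^ ('a set) \<Rightarrow> bool" where
  "minimal_extension ori K L k \<beta> =
     is_arg_min (\<lambda>\<phi>. norm (coboundary ori L k \<phi>))
       (\<lambda>\<phi>. \<phi> \<in> cochains L k \<and> restrict_cochain K k \<phi> = \<beta>)"

text \<open>The space \<open>C\<^sup>k\<^sup>+\<^sup>1\<^sub>L\<^sub>,\<^sub>K\<close>, as a function of \<open>k\<close>.\<close>

definition persistent_cochains ::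
  "('a::finite set \<Rightarrow> 'a list) \<Rightarrow> 'a set set \<Rightarrow> 'a set set \<Rightarrow> int \<Rightarrow> (real ^ ('a set)) set" where
  "persistent_cochains ori L K k =
     {\<xi> \<in> cochains L (k + 1). coboundary_adj ori L k \<xi> \<in>
        extend_zero K L k ` {\<phi> \<in> cochains K k. coboundary_adj ori K (k - 1) \<phi> = 0}}"

text \<open>
  The map whose adjoint is taken is \<open>coboundary_adj ori L k\<close> restricted to the space above and
  corestricted to the extended cochains of \<open>K\<close>.
\<close>

definition persistent_up_laplacian ::
  "('a::finite set \<Rightarrow> 'a list) \<Rightarrow> 'a set set \<Rightarrow> 'a set set \<Rightarrow> int \<Rightarrow>
   real ^ ('a set) \<Rightarrow> real ^ ('a set)" where
  "persistent_up_laplacian ori L K k =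
     coboundary_adj ori L k \<circ>
     adjoint_on (persistent_cochains ori L K k) (extend_zero K L k ` cochains K k)
       (coboundary_adj ori L k)"

end

theory Submission
  imports Defs
begin

text \<open>
  Write \<open>d\<close> for the coboundary of \<open>L\<close> in degree \<open>k\<close> and \<open>P\<close> for the cochains of \<open>L\<close> vanishing on
  \<open>K\<close>.  The minimal extension is \<open>\<beta> + p\<close> with \<open>p \<in> P\<close>, and minimality means that \<open>d (\<beta> + p)\<close> is
  orthogonal to \<open>d P\<close>.  Eliminating \<open>p\<close> from this least squares problem is the Schur
  restriction.  On the other hand, the orthogonal complement of \<open>d P\<close> in the
  \<open>(k+1)\<close>-cochains is exactly \<open>C\<^sup>k\<^sup>+\<^sup>1\<^sub>L\<^sub>,\<^sub>K\<close>: the condition on \<open>\<delta>\<^sub>K\<^sup>*\<close> in its definition is automatic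
  because \<open>\<delta>\<delta> = 0\<close>.  Hence \<open>d (\<beta> + p)\<close> is the orthogonal projection of \<open>d \<beta>\<close> to this space, and
  that projection is the adjoint defining the persistent Laplacian.
\<close>

section \<open>Orthogonal projections, adjoints and pseudoinverses on subspaces\<close>

text \<open>By Pythagoras \<open>y\<close> is at least as near to \<open>x\<close> as any
  \<open>z\<close> in \<open>S\<close>, and a closed convex set has only one nearest point.\<close>

lemma closest_point_subspace_eqI:
  fixes S :: "'a::euclidean_space set"
  assumes "subspace S" "y \<in> S" "\<And>z. z \<in> S \<Longrightarrow> (x - y) \<bullet> z = 0"
  shows "closest_point S x = y"
proof -
  have "dist x y \<le> dist x z" if "z \<in> S" for z
  proof -
    have "orthogonal (x - y) (y - z)"
      using assms that by (simp add: orthogonal_def subspace_diff)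
    then have "(norm (x - z))\<^sup>2 = (norm (x - y))\<^sup>2 + (norm (y - z))\<^sup>2"
      using norm_add_Pythagorean[of "x - y" "y - z"] by simp
    then have "(norm (x - y))\<^sup>2 \<le> (norm (x - z))\<^sup>2"
      by simp
    then show ?thesis
      by (simp add: dist_norm)
  qed
  then show ?thesis
    using closest_point_unique[of S y x] assms
    by (simp add: subspace_imp_convex closed_subspace)
qed

lemma
  fixes S :: "'a::euclidean_space set"
  assumes "subspace S"
  shows closest_point_in_subspace: "closest_point S x \<in> S"
    and inner_diff_closest_point: "z \<in> S \<Longrightarrow> (x - closest_point S x) \<bullet> z = 0"
proof -
  obtain y w where "y \<in> span S" "\<And>v. v \<in> span S \<Longrightarrow> orthogonal w v" "x = y + w"
    using orthogonal_subspace_decomp_exists[of S x] by blast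
  moreover have "span S = S"
    using assms by (simp add: span_eq_iff)
  ultimately have y: "y \<in> S" "\<And>v. v \<in> S \<Longrightarrow> (x - y) \<bullet> v = 0"
    by (auto simp: orthogonal_def)
  then have "closest_point S x = y"
    using assms by (intro closest_point_subspace_eqI)
  with y show "closest_point S x \<in> S" "z \<in> S \<Longrightarrow> (x - closest_point S x) \<bullet> z = 0"
    by auto
qed

lemma inner_closest_point_left:
  fixes S :: "'a::euclidean_space set"
  assumes "subspace S" "z \<in> S"
  shows "closest_point S x \<bullet> z = x \<bullet> z"
  using inner_diff_closest_point[OF assms, of x] by (simp add: inner_diff_left)

lemma linear_closest_point:
  fixes S :: "'a::euclidean_space set"
  assumes "subspace S"
  shows "linear (closest_point S)"
proof (rule linearI)
  fix x y :: 'a and c :: real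
  show "closest_point S (x + y) = closest_point S x + closest_point S y"
    using assms
    by (intro closest_point_subspace_eqI)
      (auto simp: subspace_add closest_point_in_subspace inner_closest_point_left algebra_simps)
  show "closest_point S (c *\<^sub>R x) = c *\<^sub>R closest_point S x"
    using assms
    by (intro closest_point_subspace_eqI)
      (auto simp: subspace_scale closest_point_in_subspace inner_closest_point_left algebra_simps)
qed

text \<open>Two candidates for the adjoint differ at \<open>v\<close> by a vector of
  \<open>U\<close> orthogonal to \<open>U\<close>, so the choice is unique on \<open>V\<close>. The
  formal adjoint \<open>g\<close> may leave \<open>U\<close>; projecting back keeps its inner
  products with \<open>U\<close>.\<close>

lemma adjoint_on_eq_closest_point:
  fixes f :: "'a::euclidean_space \<Rightarrow> 'b::euclidean_space"
  assumes U: "subspace U" and "v \<in> V"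
    and g: "\<And>u v. u \<in> U \<Longrightarrow> v \<in> V \<Longrightarrow> f u \<bullet> v = u \<bullet> g v"
  shows "adjoint_on U V f v = closest_point U (g v)"
proof -
  let ?P = "\<lambda>h. (\<forall>v\<in>V. h v \<in> U) \<and> (\<forall>u\<in>U. \<forall>v\<in>V. f u \<bullet> v = u \<bullet> h v)"
  have "?P (\<lambda>v. closest_point U (g v))"
    using U g by (simp add: closest_point_in_subspace inner_closest_point_left
        inner_commute[of _ "closest_point _ _"] inner_commute[of _ "g _"])
  then have "?P (adjoint_on U V f)"
    unfolding adjoint_on_def by (rule someI[where P = ?P])
  then have "adjoint_on U V f v \<in> U"
    and "\<And>u. u \<in> U \<Longrightarrow> u \<bullet> (g v - adjoint_on U V f v) = 0"
    using g \<open>v \<in> V\<close> by (auto simp: inner_diff_right)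
  then show ?thesis
    using U by (metis closest_point_subspace_eqI inner_commute)
qed

text \<open>On the orthogonal complement \<open>M\<close> of the kernel \<open>N\<close> in
  \<open>U\<close>, \<open>f\<close> is injective. The pseudoinverse projects onto the range and
  inverts \<open>f\<close> there, so both composites are orthogonal projections, hence
  self-adjoint.\<close>

lemma is_pinv_on_exists:
  fixes f :: "'a::euclidean_space \<Rightarrow> 'b::euclidean_space"
  assumes f: "linear f" and U: "subspace U"
  shows "\<exists>g. is_pinv_on U V f g"
proof -
  define N where "N = {u \<in> U. f u = 0}"
  define M where "M = U \<inter> {u. \<forall>n\<in>N. u \<bullet> n = 0}"
  have N: "subspace N"
    unfolding N_def using f U
    by (auto simp: subspace_def linear_add linear_scale linear_0)
  have M: "subspace M"
    unfolding M_def using U by (auto simp: subspace_def inner_add_left)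
  have "inj_on f M"
  proof (rule inj_onI)
    fix x y assume "x \<in> M" "y \<in> M" "f x = f y"
    then have xy: "x - y \<in> M" and "f (x - y) = 0"
      using M f by (simp_all add: subspace_diff linear_diff)
    then have "x - y \<in> N"
      by (simp add: N_def M_def)
    with xy have "(x - y) \<bullet> (x - y) = 0"
      unfolding M_def by blast
    then show "x = y" by simp
  qed
  then obtain h where h: "range h \<subseteq> M" "linear h" "\<And>m. m \<in> M \<Longrightarrow> h (f m) = m"
    using linear_exists_left_inverse_on[OF f M] by auto
  define R where "R = f ` M"
  have R: "subspace R"
    unfolding R_def using f M by (rule linear_subspace_image)
  \<comment> \<open>Orthogonal projection of \<open>U\<close> onto \<open>M\<close>; the part
    removed lies in the kernel of \<open>f\<close>.\<close>
  define q where "q u = u - closest_point N u" for u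
  have q: "q u \<in> M" "f (q u) = f u" "\<And>m. m \<in> M \<Longrightarrow> q u \<bullet> m = u \<bullet> m" if "u \<in> U" for u
  proof -
    have c: "closest_point N u \<in> N"
      using N by (rule closest_point_in_subspace)
    then show "f (q u) = f u"
      using f by (simp add: q_def N_def linear_diff)
    show "q u \<in> M"
      using c that U inner_diff_closest_point[OF N]
      by (auto simp: q_def M_def N_def subspace_diff)
    show "q u \<bullet> m = u \<bullet> m" if "m \<in> M" for m
      using c that by (simp add: q_def M_def inner_diff_right inner_commute[of _ m])
  qed
  let ?g = "\<lambda>v. h (closest_point R v)"
  have fg: "f (?g v) = closest_point R v" for v
    using closest_point_in_subspace[OF R, of v] h(3) by (auto simp: R_def)
  have gf: "?g (f u) = q u" if "u \<in> U" for u
  proof -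
    have "f (q u) \<in> R"
      unfolding R_def using q(1)[OF that] by (rule imageI)
    then have "closest_point R (f u) = f (q u)"
      using q[OF that] by (simp add: closest_point_self)
    with h(3)[OF q(1)[OF that]] show ?thesis by simp
  qed
  have "is_pinv_on U V f ?g"
    unfolding is_pinv_on_def
  proof (intro conjI ballI)
    show "linear ?g"
      using linear_compose[OF linear_closest_point[OF R] h(2)] by (simp add: o_def)
  next
    fix v
    show "?g v \<in> U"
      using h(1) by (auto simp: M_def)
    show "?g (f (?g v)) = ?g v"
      unfolding fg using closest_point_in_subspace[OF R] by (simp add: closest_point_self)
    fix w
    show "f (?g v) \<bullet> w = v \<bullet> f (?g w)"
      unfolding fg using R closest_point_in_subspace inner_closest_point_left
      by (metis inner_commute)
  next
    fix u assume u: "u \<in> U"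
    show "f (?g (f u)) = f u"
      using u by (simp only: gf q)
    fix w assume w: "w \<in> U"
    have "q u \<bullet> w = q u \<bullet> q w"
      using q(3)[OF w q(1)[OF u]] by (simp add: inner_commute)
    also have "\<dots> = u \<bullet> q w"
      using q(3)[OF u q(1)[OF w]] .
    finally show "?g (f u) \<bullet> w = u \<bullet> ?g (f w)"
      by (simp only: gf u w)
  qed
  then show ?thesis
    by (rule exI[of _ ?g])
qed

lemma is_pinv_on_pinv_on:
  assumes "linear f" "subspace U"
  shows "is_pinv_on U V f (pinv_on U V f)"
  unfolding pinv_on_def using is_pinv_on_exists[OF assms] by (rule someI_ex)

section \<open>Least squares and the Schur restriction\<close>

lemma minimal_norm_image_orthogonal:
  fixes d :: "'a::euclidean_space \<Rightarrow> 'b::euclidean_space"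
  assumes d: "linear d" and P: "subspace P" and "p \<in> P"
    and min: "\<And>q. q \<in> P \<Longrightarrow> norm (d (b + p)) \<le> norm (d (b + q))"
    and "q \<in> P"
  shows "d (b + p) \<bullet> d q = 0"
proof -
  have S: "subspace (d ` P)"
    using d P by (rule linear_subspace_image)
  \<comment> \<open>The minimised norm is the distance from \<open>- d b\<close> to a point of the
    image of \<open>P\<close>; at the nearest point the residual is orthogonal to that
    image.\<close>
  have "dist (- d b) (d p) \<le> dist (- d b) z" if "z \<in> d ` P" for z
  proof -
    have "dist (- d b) (d q) = norm (d (b + q))" for q
      using d norm_minus_cancel[of "d b + d q"] by (simp add: dist_norm linear_add algebra_simps)
    with that min show ?thesis by auto
  qed
  then have "d p = closest_point (d ` P) (- d b)"
    using S \<open>p \<in> P\<close> by (intro closest_point_unique)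
      (auto simp: subspace_imp_convex closed_subspace)
  then have "(- d b - d p) \<bullet> d q = 0"
    using inner_diff_closest_point[OF S, of "d q" "- d b"] \<open>q \<in> P\<close> by simp
  then show ?thesis
    using d by (simp add: linear_add algebra_simps)
qed

text \<open>
  The normal equations read \<open>D\<^sub>P\<^sub>P p = - D\<^sub>P\<^sub>W b\<close>; in particular \<open>D\<^sub>P\<^sub>W b\<close> lies in the range of
  \<open>D\<^sub>P\<^sub>P\<close>, so the pseudoinverse in the Schur restriction yields an actual solution, which
  differs from \<open>- p\<close> by an element of the kernel of \<open>d\<close>.
\<close>

lemma schur_restriction_eq_minimum:
  fixes d :: "'a::euclidean_space \<Rightarrow> 'b::euclidean_space"
  assumes d: "linear d" and D: "linear D"
    and V: "subspace V" and W: "subspace W" and "W \<subseteq> V"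
    and Dd: "\<And>x y. x \<in> V \<Longrightarrow> y \<in> V \<Longrightarrow> D x \<bullet> y = d x \<bullet> d y"
    and b: "b \<in> W" and p: "p \<in> V \<inter> orthogonal_comp W"
    and normal: "\<And>q. q \<in> V \<inter> orthogonal_comp W \<Longrightarrow> d (b + p) \<bullet> d q = 0"
  shows "schur_restriction V D W b \<bullet> b = (norm (d (b + p)))\<^sup>2"
proof -
  define P where "P = V \<inter> orthogonal_comp W"
  have P: "subspace P"
    unfolding P_def using V subspace_orthogonal_comp by (rule subspace_inter)
  have sub: "P \<subseteq> V" "p \<in> P" "b \<in> V"
    using p b \<open>W \<subseteq> V\<close> by (auto simp: P_def)
  define A where "A = block D P P"
  have A: "linear A"
    unfolding A_def block_def
    using linear_compose[OF D linear_closest_point[OF P]] by (simp add: o_def)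
  have "D (b + p) \<bullet> q = 0" if "q \<in> P" for q
    using that sub Dd[of "b + p" q] normal V by (auto simp: P_def subspace_add)
  then have "closest_point P (D (b + p)) = 0"
    using P by (intro closest_point_subspace_eqI) (auto simp: subspace_0)
  then have rhs: "block D W P b = A (- p)"
    using D A linear_closest_point[OF P] unfolding block_def A_def
    by (simp add: linear_add linear_neg eq_neg_iff_add_eq_0)
  define q where "q = pinv_on P P A (block D W P b)"
  have pinv: "is_pinv_on P P A (pinv_on P P A)"
    using A P by (rule is_pinv_on_pinv_on)
  have "q \<in> P"
    using pinv closest_point_in_subspace[OF P] by (auto simp: q_def is_pinv_on_def block_def)
  have "A q = A (- p)"
    using pinv sub P unfolding q_def rhs is_pinv_on_def by (simp add: subspace_neg)
  then have "A (q + p) = 0"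
    using A by (simp add: linear_add linear_neg)
  moreover have qp: "q + p \<in> P"
    using \<open>q \<in> P\<close> sub P by (simp add: subspace_add)
  \<comment> \<open>Testing \<open>A (q + p) = 0\<close> against \<open>q + p\<close> itself gives
    the squared norm of \<open>d (q + p)\<close>.\<close>
  ultimately have "D (q + p) \<bullet> (q + p) = 0"
    unfolding A_def block_def using inner_closest_point_left[OF P qp] by (metis inner_zero_left)
  then have "d (q + p) = 0"
    using Dd qp sub by (metis inner_eq_zero_iff subsetD)
  then have dq: "d q = - d p"
    using d by (simp add: linear_add eq_neg_iff_add_eq_0)
  have "schur_restriction V D W b \<bullet> b = D b \<bullet> b - D q \<bullet> b"
    unfolding schur_restriction_def Let_def P_def[symmetric] A_def[symmetric]
      q_def[symmetric]
    using W b by (simp add: block_def inner_diff_left inner_closest_point_left)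
  \<comment> \<open>\<open>D q \<bullet> b\<close> equals \<open>- (d p \<bullet> d b)\<close>, so
    the Schur correction supplies the mixed term.\<close>
  also have "\<dots> = d b \<bullet> d (b + p)"
    using \<open>q \<in> P\<close> sub Dd[of b b] Dd[of q b] dq d
    by (auto simp: linear_add inner_add_right inner_commute)
  \<comment> \<open>The added term \<open>d (b + p) \<bullet> d p\<close> vanishes by the normal
    equation for \<open>p\<close>.\<close>
  also have "\<dots> = d (b + p) \<bullet> d (b + p)"
    using normal[OF p] d by (simp add: linear_add inner_simps inner_commute)
  finally show ?thesis
    by (simp add: power2_norm_eq_inner)
qed

section \<open>The coboundary squares to zero\<close>

lemma reordering_sign_eq:
  assumes "p permutes set vs" "map p vs = ws"
  shows "reordering_sign vs ws = sign p"
proof -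
  have "q = p" if "q permutes set vs \<and> map q vs = ws" for q
  proof
    fix x
    show "q x = p x"
      using that assms by (cases "x \<in> set vs") (auto simp: permutes_not_in)
  qed
  then have "(THE q. q permutes set vs \<and> map q vs = ws) = p"
    using assms by blast
  then show ?thesis
    by (simp add: reordering_sign_def)
qed

lemma reordering_exists:
  assumes "distinct vs" "distinct ws" "set vs = set ws"
  obtains p where "p permutes set vs" "map p vs = ws"
proof -
  have len: "length vs = length ws"
    using assms by (metis distinct_card)
  have nth: "bij_betw ((!) vs) {..<length vs} (set vs)" "bij_betw ((!) ws) {..<length vs} (set vs)"
    using assms len by (auto intro: bij_betw_nth)
  define r where "r = inv_into {..<length vs} ((!) vs)"
  have r: "r (vs ! i) = i" if "i < length vs" for i
    using nth(1) that unfolding r_def by (simp add: bij_betw_def)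
  define p where "p x = (if x \<in> set vs then ws ! r x else x)" for x
  have "bij_betw ((!) ws \<circ> r) (set vs) (set vs)"
    unfolding r_def using nth bij_betw_inv_into bij_betw_trans by blast
  then have "bij_betw p (set vs) (set vs)"
    by (rule bij_betw_cong[THEN iffD1, rotated]) (simp add: p_def)
  then have "p permutes set vs"
    by (rule bij_imp_permutes) (simp add: p_def)
  moreover have "map p vs = ws"
    using len r by (intro nth_equalityI) (auto simp: p_def)
  ultimately show ?thesis ..
qed

lemma reordering_sign_refl [simp]: "reordering_sign vs vs = 1"
  by (subst reordering_sign_eq[of id]) (simp_all add: permutes_id)

lemma reordering_sign_trans:
  assumes "distinct us" "distinct vs" "distinct ws" "set us = set vs" "set vs = set ws"
  shows "reordering_sign us ws = reordering_sign us vs * reordering_sign vs ws"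
proof -
  obtain p where p: "p permutes set us" "map p us = vs"
    using reordering_exists[OF assms(1,2,4)] .
  obtain q where q: "q permutes set vs" "map q vs = ws"
    using reordering_exists[OF assms(2,3,5)] .
  have "reordering_sign us ws = sign (q \<circ> p)"
  proof (rule reordering_sign_eq)
    show "(q \<circ> p) permutes set us"
      using p(1) q(1)[folded assms(4)] by (rule permutes_compose)
    show "map (q \<circ> p) us = ws"
      by (simp only: map_map[symmetric] p(2) q(2))
  qed
  also have "\<dots> = sign q * sign p"
    using permutes_imp_permutation[OF finite_set q(1)] permutes_imp_permutation[OF finite_set p(1)]
    by (rule sign_compose)
  also have "\<dots> = reordering_sign us vs * reordering_sign vs ws"
    using reordering_sign_eq[OF p] reordering_sign_eq[OF q] by simp
  finally show ?thesis .
qed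

text \<open>The permutation for the tails fixes \<open>a\<close>, which lies outside
  \<open>set vs\<close>, and so serves for the longer lists too.\<close>

lemma reordering_sign_Cons:
  assumes "distinct (a # vs)" "distinct (a # ws)" "set vs = set ws"
  shows "reordering_sign (a # vs) (a # ws) = reordering_sign vs ws"
proof -
  obtain p where p: "p permutes set vs" "map p vs = ws"
    using reordering_exists assms by (metis distinct.simps(2))
  moreover have "p permutes set (a # vs)"
    using p by (auto intro: permutes_subset)
  moreover have "p a = a"
    using p assms by (simp add: permutes_not_in)
  ultimately show ?thesis
    by (simp add: reordering_sign_eq)
qed

lemma reordering_sign_swap:
  assumes "distinct (a # b # vs)"
  shows "reordering_sign (a # b # vs) (b # a # vs) = - 1"
proof -
  have "Transposition.transpose a b permutes set (a # b # vs)"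
    by (rule permutes_swap_id) auto
  moreover have "map (Transposition.transpose a b) (a # b # vs) = b # a # vs"
    using assms by (auto intro!: map_idI transpose_apply_other)
  ultimately have "reordering_sign (a # b # vs) (b # a # vs) = sign (Transposition.transpose a b)"
    by (rule reordering_sign_eq)
  with assms show ?thesis
    by (simp add: sign_swap_id)
qed

text \<open>Faces are indexed by the omitted vertex, so that sums over faces run over the vertex
  set, which reordering does not change.\<close>

definition position :: "'a \<Rightarrow> 'a list \<Rightarrow> nat" where
  "position x vs = length (takeWhile (\<lambda>y. y \<noteq> x) vs)"

lemma position_Cons [simp]: "position x (a # vs) = (if a = x then 0 else Suc (position x vs))"
  by (simp add: position_def)

lemma position_nth: "distinct vs \<Longrightarrow> i < length vs \<Longrightarrow> position (vs ! i) vs = i"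
  by (induction vs arbitrary: i) (auto simp: nth_Cons')

lemma remove1_nth:
  "distinct vs \<Longrightarrow> i < length vs \<Longrightarrow> remove1 (vs ! i) vs = take i vs @ drop (Suc i) vs"
proof (induction vs arbitrary: i)
  case (Cons a vs)
  then show ?case by (cases i) auto
qed simp

text \<open>Moving \<open>x\<close> to the front crosses each of the \<open>position x vs\<close>
  earlier entries by one adjacent swap.\<close>

lemma reordering_sign_to_front:
  assumes "distinct vs" "x \<in> set vs"
  shows "reordering_sign vs (x # remove1 x vs) = (- 1) ^ position x vs"
  using assms
proof (induction vs)
  case (Cons a vs)
  show ?case
  proof (cases "a = x")
    case False
    let ?r = "remove1 x vs"
    have x: "x \<in> set vs"
      using Cons False by simp
    \<comment> \<open>First \<open>x\<close> moves to the front of the tail, then it is swapped with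
      \<open>a\<close>.\<close>
    have "reordering_sign (a # vs) (x # a # ?r) =
        reordering_sign (a # vs) (a # x # ?r) * reordering_sign (a # x # ?r) (x # a # ?r)"
      using Cons.prems False x by (intro reordering_sign_trans) auto
    also have "reordering_sign (a # vs) (a # x # ?r) = reordering_sign vs (x # ?r)"
      using Cons.prems False x by (intro reordering_sign_Cons) auto
    also have "reordering_sign (a # x # ?r) (x # a # ?r) = - 1"
      using Cons.prems False x by (intro reordering_sign_swap) auto
    finally show ?thesis
      using Cons False by simp
  qed simp
qed simp

text \<open>Both sides are the sign of the reordering of \<open>us\<close> into \<open>x # remove1 x ws\<close>.\<close>

lemma reordering_sign_remove1:
  assumes "distinct us" "distinct ws" "set us = set ws" "x \<in> set us"
  shows "reordering_sign us ws * (- 1) ^ position x ws =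
    (- 1) ^ position x us * reordering_sign (remove1 x us) (remove1 x ws)"
proof -
  have front: "set us = set (x # remove1 x us)" "set ws = set (x # remove1 x ws)"
    "distinct (x # remove1 x us)" "distinct (x # remove1 x ws)"
    "set (remove1 x us) = set (remove1 x ws)" "set (x # remove1 x us) = set (x # remove1 x ws)"
    using assms by (simp_all add: insert_absorb)
  have "reordering_sign us ws * reordering_sign ws (x # remove1 x ws) =
      reordering_sign us (x # remove1 x ws)"
    using reordering_sign_trans[OF assms(1,2) front(4) assms(3) front(2)] by simp
  also have "\<dots> = reordering_sign us (x # remove1 x us) *
      reordering_sign (x # remove1 x us) (x # remove1 x ws)"
    using assms(1) front(3,4,1,6) by (rule reordering_sign_trans)
  also have "reordering_sign (x # remove1 x us) (x # remove1 x ws) =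
      reordering_sign (remove1 x us) (remove1 x ws)"
    using front(3-5) by (rule reordering_sign_Cons)
  finally show ?thesis
    using assms by (simp add: reordering_sign_to_front)
qed

section \<open>Cochain values and the coboundary under a change of ordering\<close>

lemma orientation_simplex:
  assumes "orientation X ori" "\<sigma> \<in> simplices X k"
  shows "distinct (ori \<sigma>)" "set (ori \<sigma>) = \<sigma>"
  using assms unfolding orientation_def simplices_def by blast+

lemma cochain_value_reorder:
  assumes "orientation X ori" "\<phi> \<in> cochains X k" "distinct vs" "distinct ws" "set vs = set ws"
  shows "cochain_value ori \<phi> ws = of_int (reordering_sign vs ws) * cochain_value ori \<phi> vs"
proof (cases "set vs \<in> X")
  case True
  then have "distinct (ori (set vs))" "set (ori (set vs)) = set vs"
    using assms(1) unfolding orientation_def by blast+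
  then have "reordering_sign (ori (set ws)) ws =
      reordering_sign (ori (set vs)) vs * reordering_sign vs ws"
    using reordering_sign_trans[of "ori (set vs)" vs ws] assms(3-5) by simp
  then show ?thesis
    using assms by (simp add: cochain_value_def)
next
  \<comment> \<open>Off \<open>X\<close> the list \<open>ori (set vs)\<close> is unconstrained, but
    \<open>\<phi>\<close> is zero there and both sides vanish.\<close>
  case False
  then show ?thesis
    using assms by (simp add: cochain_value_def cochains_def simplices_def)
qed

text \<open>The coboundary formula on an arbitrary ordering \<open>vs\<close>, with no reference to
  a complex or to the chosen ordering of \<open>set vs\<close>.\<close>

definition alternating_sum ::
  "('a::finite set \<Rightarrow> 'a list) \<Rightarrow> real ^ ('a set) \<Rightarrow> 'a list \<Rightarrow> real" where
  "alternating_sum ori \<phi> vs =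
     (\<Sum>x\<in>set vs. (- 1) ^ position x vs * cochain_value ori \<phi> (remove1 x vs))"

lemma coboundary_nth:
  assumes "orientation X ori" "\<tau> \<in> simplices X (k + 1)"
  shows "coboundary ori X k \<phi> $ \<tau> = alternating_sum ori \<phi> (ori \<tau>)"
proof -
  let ?vs = "ori \<tau>"
  have dist: "distinct ?vs"
    using assms by (rule orientation_simplex)
  have "alternating_sum ori \<phi> ?vs =
      (\<Sum>i<length ?vs. (- 1) ^ position (?vs ! i) ?vs * cochain_value ori \<phi> (remove1 (?vs ! i) ?vs))"
    unfolding alternating_sum_def
    using dist by (intro sum.reindex_bij_betw[symmetric] bij_betw_nth) auto
  also have "\<dots> = (\<Sum>i<length ?vs. (- 1) ^ i *
      cochain_value ori \<phi> (take i ?vs @ drop (Suc i) ?vs))"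
    using dist by (intro sum.cong) (auto simp: position_nth remove1_nth)
  finally show ?thesis
    using assms by (simp add: coboundary_def)
qed

lemma alternating_sum_reorder:
  assumes "orientation X ori" "\<phi> \<in> cochains X k" "distinct vs" "distinct ws" "set vs = set ws"
  shows "alternating_sum ori \<phi> ws = of_int (reordering_sign vs ws) * alternating_sum ori \<phi> vs"
proof -
  have "(- 1) ^ position x ws * cochain_value ori \<phi> (remove1 x ws) =
      of_int (reordering_sign vs ws) * ((- 1) ^ position x vs * cochain_value ori \<phi> (remove1 x vs))"
    if x: "x \<in> set vs" for x
  proof -
    let ?s = "reordering_sign vs ws" and ?t = "reordering_sign (remove1 x vs) (remove1 x ws)"
    have sq: "(- 1 :: int) ^ n * (- 1) ^ n = 1" for n
      by (simp flip: power_mult_distrib)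
    have *: "?s * (- 1) ^ position x ws = (- 1) ^ position x vs * ?t"
      using assms x by (intro reordering_sign_remove1)
    \<comment> \<open>Signs are their own inverses, so both position factors in \<open>*\<close> can
      change sides.\<close>
    have "?s * (- 1) ^ position x vs =
        (?s * (- 1) ^ position x ws) * ((- 1) ^ position x ws * (- 1) ^ position x vs)"
      using sq[of "position x ws"] by (simp add: ac_simps)
    also have "\<dots> = (- 1) ^ position x ws * ?t"
      unfolding * using sq[of "position x vs"] by (simp add: ac_simps)
    finally have "real_of_int (?s * (- 1) ^ position x vs) = of_int ((- 1) ^ position x ws * ?t)"
      by simp
    moreover have "cochain_value ori \<phi> (remove1 x ws) = of_int ?t * cochain_value ori \<phi> (remove1 x vs)"
      using assms by (intro cochain_value_reorder) auto
    ultimately show ?thesis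
      by (simp add: mult.assoc[symmetric])
  qed
  then show ?thesis
    using assms(5) by (simp add: alternating_sum_def sum_distrib_left)
qed

text \<open>Needed to iterate the coboundary: a face inherits its ordering from the larger simplex,
  which may differ from the one chosen by \<open>ori\<close>.\<close>

lemma cochain_value_coboundary:
  assumes "orientation X ori" "\<phi> \<in> cochains X k" "distinct vs" "set vs \<in> simplices X (k + 1)"
  shows "cochain_value ori (coboundary ori X k \<phi>) vs = alternating_sum ori \<phi> vs"
proof -
  note ori = orientation_simplex[OF assms(1,4)]
  have "alternating_sum ori \<phi> vs =
      of_int (reordering_sign (ori (set vs)) vs) * alternating_sum ori \<phi> (ori (set vs))"
    using assms(1,2) ori(1) assms(3) ori(2) by (rule alternating_sum_reorder)
  then show ?thesis
    using assms by (simp add: cochain_value_def coboundary_nth)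
qed

text \<open>Omitting the earlier of two vertices lowers the position of the later one by one, but
  not conversely. This is the source of the sign in the cancellation.\<close>

lemma position_remove1_swap:
  assumes "distinct vs" "x \<in> set vs" "y \<in> set vs" "x \<noteq> y"
  shows "(- 1 :: real) ^ position x vs * (- 1) ^ position y (remove1 x vs) =
    - ((- 1) ^ position y vs * (- 1) ^ position x (remove1 y vs))"
  using assms
proof (induction vs)
  case (Cons a vs)
  consider "a = x" | "a = y" | "a \<noteq> x" "a \<noteq> y" by blast
  then show ?case
  proof cases
    case 3
    with Cons have "(- 1 :: real) ^ position x vs * (- 1) ^ position y (remove1 x vs) =
        - ((- 1) ^ position y vs * (- 1) ^ position x (remove1 y vs))"
      by simp
    with 3 show ?thesis
      by (simp only: position_Cons remove1.simps if_False power_Suc) simp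
  qed (use Cons.prems in simp_all)
qed simp

lemma sum_antisymmetric_eq_0:
  fixes g :: "'b \<Rightarrow> 'b \<Rightarrow> real"
  assumes "finite A" "\<And>x y. x \<in> A \<Longrightarrow> y \<in> A \<Longrightarrow> x \<noteq> y \<Longrightarrow> g x y = - g y x"
  shows "(\<Sum>x\<in>A. \<Sum>y\<in>A - {x}. g x y) = 0"
proof -
  \<comment> \<open>A zero diagonal makes both sums range over \<open>A\<close>, so they can be
    interchanged; the total is then its own negative.\<close>
  define h where "h x y = (if x = y then 0 else g x y)" for x y
  have "(\<Sum>y\<in>A - {x}. g x y) = (\<Sum>y\<in>A. h x y)" for x
    using assms(1) by (intro sum.mono_neutral_cong_left) (auto simp: h_def)
  then have "(\<Sum>x\<in>A. \<Sum>y\<in>A - {x}. g x y) = (\<Sum>x\<in>A. \<Sum>y\<in>A. h x y)"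
    by simp
  moreover have "(\<Sum>x\<in>A. \<Sum>y\<in>A. h x y) = (\<Sum>x\<in>A. \<Sum>y\<in>A. - h y x)"
  proof (intro sum.cong refl)
    fix x y assume "x \<in> A" "y \<in> A"
    then show "h x y = - h y x"
      using assms(2)[of x y] by (cases "x = y") (simp_all add: h_def)
  qed
  moreover have "\<dots> = - (\<Sum>x\<in>A. \<Sum>y\<in>A. h x y)"
    using sum.swap[of h A A] by (simp add: sum_negf)
  ultimately show ?thesis by linarith
qed

text \<open>Expanding twice gives a sum over ordered pairs of omitted vertices. Exchanging the two
  leaves the same remaining face and reverses the sign.\<close>

lemma coboundary_coboundary:
  assumes X: "abstract_simplicial_complex X" and ori: "orientation X ori"
    and "0 \<le> k" and \<phi>: "\<phi> \<in> cochains X (k - 1)"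
  shows "coboundary ori X k (coboundary ori X (k - 1) \<phi>) = 0"
proof -
  let ?\<psi> = "coboundary ori X (k - 1) \<phi>"
  have "coboundary ori X k ?\<psi> $ \<tau> = 0" for \<tau>
  proof (cases "\<tau> \<in> simplices X (k + 1)")
    case \<tau>: True
    let ?vs = "ori \<tau>"
    have vs: "distinct ?vs" "set ?vs = \<tau>"
      using orientation_simplex[OF ori \<tau>] .
    define g where "g x y = (- 1) ^ position x ?vs * ((- 1) ^ position y (remove1 x ?vs) *
        cochain_value ori \<phi> (remove1 y (remove1 x ?vs)))" for x y
    have "cochain_value ori ?\<psi> (remove1 x ?vs) = alternating_sum ori \<phi> (remove1 x ?vs)"
      if "x \<in> \<tau>" for x
    proof -
      have card: "int (card (\<tau> - {x})) = k + 1"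
        using \<tau> card_Suc_Diff1[OF finite that] by (simp add: simplices_def)
      \<comment> \<open>Closure under faces covers only nonempty sets; the face has
        \<open>k + 1\<close> vertices, at least one.\<close>
      then have "\<tau> - {x} \<noteq> {}"
        using \<open>0 \<le> k\<close> by force
      moreover have "\<tau> \<in> X" "\<tau> - {x} \<subseteq> \<tau>"
        using \<tau> by (auto simp: simplices_def)
      ultimately have "\<tau> - {x} \<in> X"
        using X unfolding abstract_simplicial_complex_def by metis
      with card have "set (remove1 x ?vs) \<in> simplices X (k - 1 + 1)"
        using vs by (simp add: simplices_def)
      then show ?thesis
        using ori \<phi> vs by (intro cochain_value_coboundary) auto
    qed
    then have "coboundary ori X k ?\<psi> $ \<tau> = (\<Sum>x\<in>\<tau>. \<Sum>y\<in>\<tau> - {x}. g x y)"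
      using coboundary_nth[OF ori \<tau>] vs
      by (simp add: alternating_sum_def g_def sum_distrib_left)
    also have "\<dots> = 0"
    proof (rule sum_antisymmetric_eq_0)
      fix x y assume "x \<in> \<tau>" "y \<in> \<tau>" "x \<noteq> y"
      then show "g x y = - g y x"
        using position_remove1_swap[of ?vs x y] vs
        by (simp add: g_def mult.assoc[symmetric] remove1_commute[of y x])
    qed simp
    finally show ?thesis .
  qed (simp add: coboundary_def)
  then show ?thesis
    by (simp add: vec_eq_iff)
qed

section \<open>Pairs of complexes\<close>

lemma subspace_cochains: "subspace (cochains X k)"
  by (auto simp: subspace_def cochains_def)

lemma linear_coboundary: "linear (coboundary ori X k)"
  by (rule linearI)
    (auto simp: coboundary_def cochain_value_def vec_eq_iff algebra_simps sum.distrib sum_distrib_left)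

lemma coboundary_in_cochains: "coboundary ori X k \<phi> \<in> cochains X (k + 1)"
  by (simp add: coboundary_def cochains_def)

text \<open>The coboundary is linear on the whole ambient space, so its ambient adjoint is a formal
  adjoint, to be projected to the \<open>k\<close>-cochains.\<close>

lemma coboundary_adj_eq_closest_point:
  assumes "\<xi> \<in> cochains X (k + 1)"
  shows "coboundary_adj ori X k \<xi> = closest_point (cochains X k) (adjoint (coboundary ori X k) \<xi>)"
  unfolding coboundary_adj_def using assms
  by (intro adjoint_on_eq_closest_point)
    (auto simp: subspace_cochains adjoint_works[OF linear_coboundary])

lemma coboundary_adj_in_cochains:
  "\<xi> \<in> cochains X (k + 1) \<Longrightarrow> coboundary_adj ori X k \<xi> \<in> cochains X k"
  by (simp add: coboundary_adj_eq_closest_point closest_point_in_subspace subspace_cochains)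

lemma inner_coboundary_adj:
  assumes "\<xi> \<in> cochains X (k + 1)" "\<phi> \<in> cochains X k"
  shows "coboundary_adj ori X k \<xi> \<bullet> \<phi> = \<xi> \<bullet> coboundary ori X k \<phi>"
  using assms
  by (simp add: coboundary_adj_eq_closest_point inner_closest_point_left subspace_cochains
      adjoint_clauses(2)[OF linear_coboundary])

text \<open>\<open>coboundary_adj\<close> is controlled only on \<open>(k+1)\<close>-cochains, but
  \<open>coboundary\<close> always lands there, even from arbitrary ambient vectors.\<close>

lemma linear_up_laplacian: "linear (up_laplacian ori X k)"
proof -
  have "up_laplacian ori X k =
      closest_point (cochains X k) \<circ> (adjoint (coboundary ori X k) \<circ> coboundary ori X k)"
    by (auto simp: up_laplacian_def coboundary_adj_eq_closest_point coboundary_in_cochains)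
  then show ?thesis
    by (simp add: linear_compose adjoint_linear linear_coboundary linear_closest_point
        subspace_cochains)
qed

lemma inner_up_laplacian:
  "\<phi> \<in> cochains X k \<Longrightarrow>
    up_laplacian ori X k \<psi> \<bullet> \<phi> = coboundary ori X k \<psi> \<bullet> coboundary ori X k \<phi>"
  by (simp add: up_laplacian_def inner_coboundary_adj coboundary_in_cochains)

section \<open>Cochains of a subcomplex and their orthogonal complement\<close>

lemma simplices_mono: "K \<subseteq> L \<Longrightarrow> simplices K k \<subseteq> simplices L k"
  by (auto simp: simplices_def)

lemma cochains_mono: "K \<subseteq> L \<Longrightarrow> cochains K k \<subseteq> cochains L k"
  by (auto simp: cochains_def simplices_def)

lemma extend_zero_id:
  assumes "K \<subseteq> L" "\<phi> \<in> cochains K k"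
  shows "extend_zero K L k \<phi> = \<phi>"
  using assms simplices_mono[OF assms(1), of k] by (auto simp: extend_zero_def cochains_def vec_eq_iff)

lemma extend_zero_image:
  assumes "K \<subseteq> L" "S \<subseteq> cochains K k"
  shows "extend_zero K L k ` S = S"
proof -
  have "extend_zero K L k ` S = (\<lambda>\<phi>. \<phi>) ` S"
    using assms by (intro image_cong) (auto intro: extend_zero_id)
  then show ?thesis by simp
qed

lemma axis_in_cochains: "\<sigma> \<in> simplices X k \<Longrightarrow> axis \<sigma> 1 \<in> cochains X k"
  by (auto simp: cochains_def axis_def)

lemma orthogonal_comp_cochains:
  "orthogonal_comp (cochains K k) = {\<phi>. \<forall>\<sigma>\<in>simplices K k. \<phi> $ \<sigma> = 0}"
proof (intro set_eqI iffI)
  fix \<phi> :: "real ^ ('a set)"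
  assume "\<phi> \<in> orthogonal_comp (cochains K k)"
  then have "axis \<sigma> 1 \<bullet> \<phi> = 0" if "\<sigma> \<in> simplices K k" for \<sigma>
    using axis_in_cochains[OF that] by (auto simp: orthogonal_comp_def orthogonal_def)
  then show "\<phi> \<in> {\<phi>. \<forall>\<sigma>\<in>simplices K k. \<phi> $ \<sigma> = 0}"
    by (simp add: inner_axis inner_commute[of "axis _ _"])
next
  fix \<phi> :: "real ^ ('a set)"
  assume *: "\<phi> \<in> {\<phi>. \<forall>\<sigma>\<in>simplices K k. \<phi> $ \<sigma> = 0}"
  have "\<psi> \<bullet> \<phi> = 0" if "\<psi> \<in> cochains K k" for \<psi>
    unfolding inner_vec_def
    using * that by (intro sum.neutral) (auto simp: cochains_def)
  then show "\<phi> \<in> orthogonal_comp (cochains K k)"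
    by (simp add: orthogonal_comp_def orthogonal_def)
qed

text \<open>The coordinate vector of a simplex of \<open>L\<close> outside \<open>K\<close> is an
  admissible \<open>p\<close> and reads off that entry of \<open>\<phi>\<close>.\<close>

lemma cochains_subcomplexI:
  assumes "\<phi> \<in> cochains L k"
    and "\<And>p. p \<in> cochains L k \<inter> orthogonal_comp (cochains K k) \<Longrightarrow> \<phi> \<bullet> p = 0"
  shows "\<phi> \<in> cochains K k"
proof -
  have "\<phi> $ \<sigma> = 0" if "\<sigma> \<notin> simplices K k" for \<sigma>
  proof (cases "\<sigma> \<in> simplices L k")
    case True
    then have "axis \<sigma> 1 \<in> cochains L k \<inter> orthogonal_comp (cochains K k)"
      using that axis_in_cochains[OF True]
      by (auto simp: orthogonal_comp_cochains axis_def)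
    then show ?thesis
      using assms(2) by (force simp: inner_axis)
  next
    case False
    then show ?thesis
      using assms(1) by (simp add: cochains_def)
  qed
  then show ?thesis
    by (simp add: cochains_def)
qed

text \<open>On simplices of \<open>K\<close> both coboundaries are the same face sum, as
  \<open>ori\<close> is shared; elsewhere \<open>\<psi>\<close> is zero.\<close>

lemma inner_coboundary_subcomplex:
  assumes "K \<subseteq> L" "\<psi> \<in> cochains K (k + 1)"
  shows "\<psi> \<bullet> coboundary ori L k \<phi> = \<psi> \<bullet> coboundary ori K k \<phi>"
  unfolding inner_vec_def
proof (rule sum.cong)
  fix \<sigma>
  show "\<psi> $ \<sigma> \<bullet> coboundary ori L k \<phi> $ \<sigma> = \<psi> $ \<sigma> \<bullet> coboundary ori K k \<phi> $ \<sigma>"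
  proof (cases "\<sigma> \<in> simplices K (k + 1)")
    case True
    then show ?thesis
      using simplices_mono[OF \<open>K \<subseteq> L\<close>] by (auto simp: coboundary_def)
  next
    case False
    then show ?thesis
      using assms(2) by (simp add: cochains_def)
  qed
qed simp

section \<open>Persistent cochains and the persistent Laplacian\<close>

lemma persistent_cochains_eq:
  assumes "abstract_simplicial_complex L" "K \<subseteq> L" "orientation L ori" "0 \<le> k"
  shows "persistent_cochains ori L K k = {\<xi> \<in> cochains L (k + 1).
    \<forall>p \<in> cochains L k \<inter> orthogonal_comp (cochains K k). \<xi> \<bullet> coboundary ori L k p = 0}"
proof -
  have "coboundary_adj ori L k \<xi> \<in> {\<phi> \<in> cochains K k. coboundary_adj ori K (k - 1) \<phi> = 0} \<longleftrightarrow>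
      (\<forall>p \<in> cochains L k \<inter> orthogonal_comp (cochains K k). \<xi> \<bullet> coboundary ori L k p = 0)"
    (is "?l \<longleftrightarrow> ?r") if \<xi>: "\<xi> \<in> cochains L (k + 1)" for \<xi>
  proof
    assume ?l
    then have "coboundary_adj ori L k \<xi> \<bullet> p = 0"
      if "p \<in> cochains L k \<inter> orthogonal_comp (cochains K k)" for p
      using that by (auto simp: orthogonal_comp_def orthogonal_def)
    then show ?r
      using inner_coboundary_adj[OF \<xi>] by (metis IntD1)
  next
    assume ?r
    define w where "w = coboundary_adj ori L k \<xi>"
    have "w \<in> cochains L k"
      unfolding w_def using \<xi> by (rule coboundary_adj_in_cochains)
    \<comment> \<open>Moving the coboundary across, \<open>?r\<close> says that \<open>w\<close> is
      orthogonal to every cochain of \<open>L\<close> vanishing on \<open>K\<close>.\<close>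
    then have w: "w \<in> cochains K k"
      by (rule cochains_subcomplexI) (use \<open>?r\<close> \<xi> in \<open>auto simp: w_def inner_coboundary_adj\<close>)
    define \<alpha> where "\<alpha> = coboundary_adj ori K (k - 1) w"
    have \<alpha>: "\<alpha> \<in> cochains K (k - 1)"
      unfolding \<alpha>_def using w by (intro coboundary_adj_in_cochains) simp
    then have \<alpha>L: "\<alpha> \<in> cochains L (k - 1)"
      using cochains_mono[OF \<open>K \<subseteq> L\<close>] by auto
    \<comment> \<open>The squared norm of \<open>\<alpha>\<close> is rewritten, by moving both
      adjoints across, as \<open>\<xi>\<close> paired with a double coboundary in
      \<open>L\<close>.\<close>
    have "\<alpha> \<bullet> \<alpha> = w \<bullet> coboundary ori K (k - 1) \<alpha>"
      unfolding \<alpha>_def using w \<alpha>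
      by (intro inner_coboundary_adj) (auto simp: \<alpha>_def)
    also have "\<dots> = w \<bullet> coboundary ori L (k - 1) \<alpha>"
      using inner_coboundary_subcomplex[OF \<open>K \<subseteq> L\<close>, of w "k - 1"] w by simp
    also have "\<dots> = \<xi> \<bullet> coboundary ori L k (coboundary ori L (k - 1) \<alpha>)"
      unfolding w_def using \<xi> coboundary_in_cochains[of ori L "k - 1" \<alpha>]
      by (intro inner_coboundary_adj) auto
    also have "\<dots> = 0"
      using coboundary_coboundary[OF assms(1,3,4) \<alpha>L] by simp
    finally have "\<alpha> = 0" by simp
    with w show ?l
      by (simp add: w_def \<alpha>_def)
  qed
  then show ?thesis
    using assms(2) by (auto simp: persistent_cochains_def extend_zero_image)
qed

lemma persistent_up_laplacian_eq_minimum: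
  assumes "abstract_simplicial_complex L" "K \<subseteq> L" "orientation L ori" "0 \<le> k"
    and b: "b \<in> cochains K k" and p: "p \<in> cochains L k \<inter> orthogonal_comp (cochains K k)"
    and normal: "\<And>q. q \<in> cochains L k \<inter> orthogonal_comp (cochains K k) \<Longrightarrow>
      coboundary ori L k (b + p) \<bullet> coboundary ori L k q = 0"
  shows "persistent_up_laplacian ori L K k b \<bullet> b = (norm (coboundary ori L k (b + p)))\<^sup>2"
proof -
  let ?d = "coboundary ori L k" and ?Z = "persistent_cochains ori L K k"
  note Z = persistent_cochains_eq[OF assms(1-4)]
  have WV: "cochains K k \<subseteq> cochains L k"
    using assms(2) by (rule cochains_mono)
  have add: "?d (b + p) = ?d b + ?d p"
    using linear_coboundary by (rule linear_add)
  have subspace: "subspace ?Z"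
    unfolding Z using subspace_cochains[of L "k + 1"]
    by (auto simp: subspace_def inner_add_left)
  \<comment> \<open>The coboundary is the formal adjoint here, but \<open>?d b\<close> may lie
    outside \<open>?Z\<close>, hence the projection.\<close>
  have "adjoint_on ?Z (cochains K k) (coboundary_adj ori L k) b = closest_point ?Z (?d b)"
    using subspace b WV
    by (intro adjoint_on_eq_closest_point) (auto simp: Z inner_coboundary_adj)
  also have "\<dots> = ?d (b + p)"
    using subspace
  proof (rule closest_point_subspace_eqI)
    show "?d (b + p) \<in> ?Z"
      using normal by (simp add: Z coboundary_in_cochains)
    \<comment> \<open>The difference is \<open>- ?d p\<close>, which is orthogonal to
      \<open>?Z\<close> by the characterisation \<open>Z\<close>.\<close>
    show "(?d b - ?d (b + p)) \<bullet> z = 0" if "z \<in> ?Z" for z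
      using that p by (auto simp: Z add inner_commute[of _ z])
  qed
  finally have "persistent_up_laplacian ori L K k b \<bullet> b = ?d (b + p) \<bullet> ?d b"
    using assms(2) b WV
    by (auto simp: persistent_up_laplacian_def extend_zero_image inner_coboundary_adj
        coboundary_in_cochains)
  also have "\<dots> = ?d (b + p) \<bullet> ?d (b + p)"
    using normal[OF p] by (simp add: add inner_add_right)
  finally show ?thesis
    by (simp add: power2_norm_eq_inner)
qed

text \<open>The extensions of \<open>b\<close> form the affine space of all \<open>b + q\<close>
  with \<open>q\<close> vanishing on \<open>K\<close>, so minimality is a least squares problem over
  a subspace.\<close>

lemma minimal_extension_normal:
  assumes "K \<subseteq> L" and b: "b \<in> cochains K k" and min: "minimal_extension ori K L k b \<phi>"
  obtains p where "p \<in> cochains L k \<inter> orthogonal_comp (cochains K k)" "\<phi> = b + p"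
    "\<And>q. q \<in> cochains L k \<inter> orthogonal_comp (cochains K k) \<Longrightarrow>
      coboundary ori L k (b + p) \<bullet> coboundary ori L k q = 0"
proof -
  let ?d = "coboundary ori L k" and ?P = "cochains L k \<inter> orthogonal_comp (cochains K k)"
  have bL: "b \<in> cochains L k"
    using cochains_mono[OF assms(1)] b by auto
  have ext: "\<psi> - b \<in> ?P \<longleftrightarrow> \<psi> \<in> cochains L k \<and> restrict_cochain K k \<psi> = b" for \<psi>
  proof -
    have "\<psi> - b \<in> cochains L k \<longleftrightarrow> \<psi> \<in> cochains L k"
      using bL by (simp add: cochains_def)
    moreover have "\<psi> - b \<in> orthogonal_comp (cochains K k) \<longleftrightarrow> restrict_cochain K k \<psi> = b"
      unfolding orthogonal_comp_cochains
      using b by (auto simp: restrict_cochain_def cochains_def vec_eq_iff)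
    ultimately show ?thesis by simp
  qed
  have p: "\<phi> - b \<in> ?P"
    unfolding ext using min by (simp add: minimal_extension_def is_arg_min_def)
  moreover have "?d (b + (\<phi> - b)) \<bullet> ?d q = 0" if "q \<in> ?P" for q
  proof (rule minimal_norm_image_orthogonal[OF linear_coboundary _ p _ that])
    show "subspace ?P"
      using subspace_cochains subspace_orthogonal_comp by (rule subspace_inter)
    show "norm (?d (b + (\<phi> - b))) \<le> norm (?d (b + q'))" if "q' \<in> ?P" for q'
      using min ext[of "b + q'"] that
      by (auto simp: minimal_extension_def is_arg_min_linorder)
  qed
  ultimately show ?thesis
    by (intro that[of "\<phi> - b"]) auto
qed

theorem theorem4p6:
  fixes K L :: "'a::finite set set"
    and ori :: "'a set \<Rightarrow> 'a list"
    and k :: int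
    and \<beta> \<beta>_hat :: "real ^ ('a set)"
  assumes "abstract_simplicial_complex L"
    and "abstract_simplicial_complex K"
    and "K \<subseteq> L"
    and "orientation L ori"
    and "0 \<le> k"
    and "\<beta> \<in> cocycles ori K k"
    and "dies ori K L k \<beta>"
    and "minimal_extension ori K L k \<beta> \<beta>_hat"
  shows "(norm (coboundary ori L k \<beta>_hat))\<^sup>2 =
           schur_restriction (cochains L k) (up_laplacian ori L k)
             (extend_zero K L k ` cochains K k) (extend_zero K L k \<beta>) \<bullet> extend_zero K L k \<beta>
         \<and> (\<beta> \<in> harmonic_cochains ori K k \<longrightarrow>
             (norm (coboundary ori L k \<beta>_hat))\<^sup>2 =
             persistent_up_laplacian ori L K k (extend_zero K L k \<beta>) \<bullet> extend_zero K L k \<beta>)"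
proof -
  have \<beta>: "\<beta> \<in> cochains K k"
    using assms(6) by (simp add: cocycles_def)
  obtain p where p: "p \<in> cochains L k \<inter> orthogonal_comp (cochains K k)" "\<beta>_hat = \<beta> + p"
    and normal: "\<And>q. q \<in> cochains L k \<inter> orthogonal_comp (cochains K k) \<Longrightarrow>
      coboundary ori L k (\<beta> + p) \<bullet> coboundary ori L k q = 0"
    using minimal_extension_normal[OF assms(3) \<beta> assms(8)] by blast
  have "schur_restriction (cochains L k) (up_laplacian ori L k) (cochains K k) \<beta> \<bullet> \<beta> =
      (norm (coboundary ori L k (\<beta> + p)))\<^sup>2"
    using linear_coboundary linear_up_laplacian subspace_cochains subspace_cochains
      cochains_mono[OF assms(3)] inner_up_laplacian \<beta> p(1) normal
    by (rule schur_restriction_eq_minimum)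
  moreover have "persistent_up_laplacian ori L K k \<beta> \<bullet> \<beta> =
      (norm (coboundary ori L k (\<beta> + p)))\<^sup>2"
    using assms(1,3-5) \<beta> p(1) normal by (rule persistent_up_laplacian_eq_minimum)
  \<comment> \<open>Extension by zero is the identity on cochains of \<open>K\<close>, so both
    formulas apply to the embedded cochain.\<close>
  ultimately show ?thesis
    using assms(3) \<beta> p(2) by (simp add: extend_zero_id extend_zero_image)
qed

end
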